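(* Let $G$ be a group of prime order $n$. Then $$\mathbb{C}[\mathbf{x}]^{\operatorname{SL}(\mathbb{C}G)} = \mathbb{C}[\mathbf{x}]^{D} = \mathbb{C}[\mathbf{x}]^{\Delta}.$$
   Context: $\mathbf{x} = {}^t(x_0, \ldots, x_{n-1})$ is a column vector of variables and $\mathbb{C}[\mathbf{x}] = \mathbb{C}[x_0,\ldots,x_{n-1}]$, where $n = |G|$. With the conventions $x_{-1} := x_{n-1}$ and $x_n := x_0$, define $$D := \sum_{i=0}^{n-1} x_{i-1}\frac{\partial}{\partial x_i}, \qquad \Delta := \sum_{i=0}^{n-1} x_{i+1}\frac{\partial}{\partial x_i},$$ and $\mathbb{C}[\mathbf{x}]^{D} := \{f \in \mathbb{C}[\mathbf{x}] \mid Df = 0\}$, $\mathbb{C}[\mathbf{x}]^{\Delta} := \{f \in \mathbb{C}[\mathbf{x}] \mid \Delta f = 0\}$. For $G$ cyclic of order $n$, $\operatorname{SL}(\mathbb{C}G)$ is the set of all matrices in $\operatorname{SL}(n,\mathbb{C})$ that are circulant, i.e. whose $(r,s)$ entry ($0 \le r,s \le n-1$) is $a_{(r-s) \bmod n}$ for some $a_0,\ldots,a_{n-1} \in \mathbb{C}$, and $$\mathbb{C}[\mathbf{x}]^{\operatorname{SL}(\mathbb{C}G)} := \{ f(\mathbf{x}) \in \mathbb{C}[\mathbf{x}] \mid f(A\mathbf{x}) = f(\mathbf{x}) \text{ for any } A \in \operatorname{SL}(\mathbb{C}G) \}.$$ *)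

theory Defs
  imports "HOL-Library.Poly_Mapping" "HOL-Algebra.Coset"
    "HOL-Computational_Algebra.Primes" "Jordan_Normal_Form.Determinant"
begin

text \<open>
  Polynomials over the complex numbers in variables \<open>x\<^sub>0, x\<^sub>1, \<dots>\<close>, as finitely supported maps from
  exponent vectors to coefficients; multiplication on this type is convolution.
\<close>

type_synonym cpoly = "(nat \<Rightarrow>\<^sub>0 nat) \<Rightarrow>\<^sub>0 complex"

definition poly_ring :: "nat \<Rightarrow> cpoly set" where
  "poly_ring n = {f. \<forall>m \<in> Poly_Mapping.keys f. Poly_Mapping.keys m \<subseteq> {..<n}}"

definition pvar :: "nat \<Rightarrow> cpoly" where
  "pvar i = Poly_Mapping.single (Poly_Mapping.single i 1) 1"

definition pconst :: "complex \<Rightarrow> cpoly" where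
  "pconst c = Poly_Mapping.single 0 c"

text \<open>
  If \<open>x\<^sub>i\<close> does not occur in the monomial \<open>m\<close>, the truncated subtraction below is harmless, since
  the coefficient is then \<open>0\<close>.
\<close>

definition pderiv_wrt :: "nat \<Rightarrow> cpoly \<Rightarrow> cpoly" where
  "pderiv_wrt i f = (\<Sum>m \<in> Poly_Mapping.keys f.
     Poly_Mapping.single (m - Poly_Mapping.single i 1)
       (of_nat (Poly_Mapping.lookup m i) * Poly_Mapping.lookup f m))"

definition psubst :: "(nat \<Rightarrow> cpoly) \<Rightarrow> cpoly \<Rightarrow> cpoly" where
  "psubst g f = (\<Sum>m \<in> Poly_Mapping.keys f.
     pconst (Poly_Mapping.lookup f m) *
       (\<Prod>i \<in> Poly_Mapping.keys m. g i ^ Poly_Mapping.lookup m i))"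

text \<open>The polynomial \<open>f(A x)\<close>, where \<open>x\<close> is the column vector of the first \<open>dim_col A\<close> variables.\<close>

definition mat_act :: "complex mat \<Rightarrow> cpoly \<Rightarrow> cpoly" where
  "mat_act A f = psubst (\<lambda>i. \<Sum>j<dim_col A. pconst (A $$ (i, j)) * pvar j) f"

text \<open>Variable indices are read modulo \<open>n\<close>; in \<open>op_D\<close> the summand \<open>n\<close> avoids truncation at \<open>i = 0\<close>.\<close>

definition op_D :: "nat \<Rightarrow> cpoly \<Rightarrow> cpoly" where
  "op_D n f = (\<Sum>i<n. pvar ((i + n - 1) mod n) * pderiv_wrt i f)"

definition op_Delta :: "nat \<Rightarrow> cpoly \<Rightarrow> cpoly" where
  "op_Delta n f = (\<Sum>i<n. pvar ((i + 1) mod n) * pderiv_wrt i f)"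

definition ker_D :: "nat \<Rightarrow> cpoly set" where
  "ker_D n = {f \<in> poly_ring n. op_D n f = 0}"

definition ker_Delta :: "nat \<Rightarrow> cpoly set" where
  "ker_Delta n = {f \<in> poly_ring n. op_Delta n f = 0}"

definition SL :: "nat \<Rightarrow> complex mat set" where
  "SL n = {A \<in> carrier_mat n n. det A = 1}"

definition circulant :: "nat \<Rightarrow> complex mat \<Rightarrow> bool" where
  "circulant n A \<longleftrightarrow> A \<in> carrier_mat n n \<and>
     (\<exists>a :: nat \<Rightarrow> complex. \<forall>r<n. \<forall>s<n. A $$ (r, s) = a (nat ((int r - int s) mod int n)))"

text \<open>
  \<open>SL_cyclic n\<close> is \<open>SL(\<complex>G)\<close> for a cyclic group \<open>G\<close> of order \<open>n\<close>. Ordering \<open>G\<close> as the powers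
  \<open>1, g, \<dots>, g\<^sup>n\<^sup>-\<^sup>1\<close> of a generator, it depends only on \<open>n\<close>.
\<close>

definition SL_cyclic :: "nat \<Rightarrow> complex mat set" where
  "SL_cyclic n = {A \<in> SL n. circulant n A}"

definition invariants_SL_cyclic :: "nat \<Rightarrow> cpoly set" where
  "invariants_SL_cyclic n = {f \<in> poly_ring n. \<forall>A \<in> SL_cyclic n. mat_act A f = f}"

end

theory Submission
  imports Defs "Jordan_Normal_Form.Char_Poly" "HOL-Computational_Algebra.Polynomial_Factorial"
begin

text \<open>
  Let \<open>w\<close> be a primitive \<open>n\<close>-th root of unity and \<open>y\<^sub>k = \<Sum>\<^sub>j w\<^sup>k\<^sup>j x\<^sub>j\<close>. These linear forms are again
  coordinates of the polynomial ring (\<open>psubst_dft_form_surj\<close>, \<open>psubst_dft_form_inj\<close>), and in them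
  everything is diagonal. The derivations \<open>D\<close> and \<open>\<Delta>\<close> multiply \<open>y\<^sub>k\<close> by \<open>w\<^sup>k\<close> and \<open>w\<^sup>-\<^sup>k\<close>
  (\<open>vector_field_dft_form\<close>), so a monomial with exponents \<open>m\<^sub>k\<close> in the \<open>y\<^sub>k\<close> is an eigenvector with
  eigenvalue \<open>\<Sum>\<^sub>k m\<^sub>k w\<^sup>k\<close>, respectively \<open>\<Sum>\<^sub>k m\<^sub>k w\<^sup>-\<^sup>k\<close>. A circulant matrix multiplies \<open>y\<^sub>k\<close> by its
  eigenvalue \<open>d\<^sub>k\<close> (\<open>mat_act_circ_mat_dft_form\<close>), its determinant is the product of the \<open>d\<^sub>k\<close>, and every
  choice of the \<open>d\<^sub>k\<close> occurs (\<open>det_circ_mat\<close>, \<open>circ_mat_with_eigenvalues\<close>); it multiplies the monomial by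
  \<open>\<Prod>\<^sub>k d\<^sub>k ^ m\<^sub>k\<close>.

  Hence each of the three subspaces is spanned by monomials in the \<open>y\<^sub>k\<close>
  (\<open>diagonal_operator_psubst_eq_0_iff\<close>), and it remains to see that they are the same monomials,
  namely those whose exponents are all equal. For the group this holds because \<open>\<Prod>\<^sub>k d\<^sub>k ^ m\<^sub>k = 1\<close>
  whenever \<open>\<Prod>\<^sub>k d\<^sub>k = 1\<close> means that the exponent vector is constant (\<open>invariant_iff_balanced\<close>). For the
  derivations it is the fact that, for prime \<open>n\<close>, a vanishing integer combination of
  \<open>1, w, \<dots>, w\<^sup>n\<^sup>-\<^sup>1\<close> has all coefficients equal (\<open>integer_relation_roots_of_unity_prime\<close>), which
  expresses irreducibility of the cyclotomic polynomial \<open>1 + x + \<dots> + x\<^sup>n\<^sup>-\<^sup>1\<close>, a consequence of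
  Eisenstein's criterion.
\<close>

section \<open>Integer relations between roots of unity of prime order\<close>

lemma eisenstein:
  fixes P :: "int poly" and p :: int
  assumes p: "prime p" and deg: "degree P > 0" and monic: "lead_coeff P = 1"
    and low: "\<And>i. i < degree P \<Longrightarrow> p dvd coeff P i"
    and const: "\<not> p\<^sup>2 dvd coeff P 0"
  shows "irreducible P"
proof (rule irreducibleI)
  show "P \<noteq> 0" using deg by auto
  show "\<not> P dvd 1" using deg by (auto simp: is_unit_poly_iff)
next
  fix a b assume Pab: "P = a * b"
  have nz: "a \<noteq> 0" "b \<noteq> 0" using deg Pab by auto
  have lc: "lead_coeff a * lead_coeff b = 1"
    using monic unfolding Pab by (simp add: lead_coeff_mult)
  have degs: "degree P = degree a + degree b"
    unfolding Pab by (rule degree_mult_eq) (use nz in auto)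
  have unit: "u dvd 1" if "degree u = 0" "lead_coeff u dvd 1" for u :: "int poly"
    using that by (auto simp: is_unit_poly_iff elim!: degree_eq_zeroE)
  have main: False if ab: "P = u * v" and du: "0 < degree v" and dP: "degree P = degree u + degree v"
    and pu: "p dvd coeff u 0" and lcu: "lead_coeff u dvd 1" for u v :: "int poly"
  proof -
    have nv: "\<not> p dvd coeff v 0"
    proof
      assume "p dvd coeff v 0"
      with pu have "p\<^sup>2 dvd coeff u 0 * coeff v 0" by (simp add: power2_eq_square mult_dvd_mono)
      with const show False unfolding ab by (simp add: coeff_mult_0)
    qed
    have "\<exists>k. \<not> p dvd coeff u k"
    proof -
      have "\<not> p dvd lead_coeff u" using lcu p not_prime_unit dvd_trans by blast
      thus ?thesis by blast
    qed
    (* The first coefficient of u that p does not divide makes p fail to divide the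
       coefficient of P = u * v of the same degree, which is below the leading one. *)
    define k where "k = (LEAST k. \<not> p dvd coeff u k)"
    have k: "\<not> p dvd coeff u k" unfolding k_def by (rule LeastI_ex) fact
    have klt: "p dvd coeff u i" if "i < k" for i using that not_less_Least unfolding k_def by blast
    have "k \<le> degree u"
      using k by (metis coeff_eq_0 dvd_0_right not_le)
    hence "k < degree P" using dP du by simp
    hence "p dvd coeff P k" by (rule low)
    also have "coeff P k = (\<Sum>i<k. coeff u i * coeff v (k - i)) + coeff u k * coeff v 0"
      unfolding ab coeff_mult by (simp flip: lessThan_Suc_atMost)
    finally have "p dvd coeff u k * coeff v 0"
      using klt by (subst (asm) dvd_add_right_iff) (auto intro!: dvd_sum)
    thus False using p k nv by (simp add: prime_dvd_mult_iff)
  qed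
  show "a dvd 1 \<or> b dvd 1"
  proof (rule ccontr)
    assume n: "\<not> ?thesis"
    have lu: "lead_coeff a dvd 1" "lead_coeff b dvd 1" using dvd_triv_left[of "lead_coeff a" "lead_coeff b"] dvd_triv_right[of "lead_coeff b" "lead_coeff a"]
    unfolding lc by blast+
    have da: "0 < degree a" and db: "0 < degree b" using n unit lu by blast+
    have "p dvd coeff a 0 * coeff b 0" using low[of 0] deg unfolding Pab by (simp add: coeff_mult_0)
    hence "p dvd coeff a 0 \<or> p dvd coeff b 0" using p by (simp add: prime_dvd_mult_iff)
    thus False
      using main[of a b] main[of b a] Pab degs da db lu by (auto simp: mult.commute)
  qed
qed

lemma irreducible_if_irreducible_shift:
  fixes P :: "'a :: comm_ring_1 poly"
  assumes "irreducible (pcompose P [:c, 1:])"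
  shows "irreducible P"
proof (rule irreducibleI)
  let ?s = "\<lambda>q. pcompose q [:c, 1:]"
  have unshift: "pcompose (?s q) [:-c, 1:] = q" for q :: "'a poly"
    by (simp add: pcompose_assoc[symmetric] pcompose_pCons)
  have unit: "q dvd 1" if "?s q dvd 1" for q
  proof -
    from that obtain r where "1 = ?s q * r" by (rule dvdE)
    hence "pcompose 1 [:-c, 1:] = pcompose (?s q * r) [:-c, 1:]" by simp
    hence "1 = q * pcompose r [:-c, 1:]" by (simp add: pcompose_mult unshift pcompose_1)
    thus ?thesis by (rule dvdI)
  qed
  show "P \<noteq> 0" using assms by auto
  show "\<not> P dvd 1"
  proof
    assume "P dvd 1"
    then obtain r where "1 = P * r" by (rule dvdE)
    hence "1 = ?s P * ?s r" by (metis pcompose_mult pcompose_1)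
    thus False using assms by (metis dvdI irreducible_def)
  qed
  fix a b assume "P = a * b"
  hence "?s P = ?s a * ?s b" by (simp add: pcompose_mult)
  thus "a dvd 1 \<or> b dvd 1" using irreducibleD[OF assms] unit by blast
qed

text \<open>
  Since \<open>(x - 1) \<phi>(x) = x\<^sup>n - 1\<close>, shifting the variable by one turns \<open>\<phi>\<close> into
  \<open>((x + 1)\<^sup>n - 1) / x\<close>, whose coefficients are the binomial coefficients \<open>n choose (k + 1)\<close>.
  For prime \<open>n\<close> Eisenstein's criterion applies to this shifted polynomial.
\<close>
lemma irreducible_cyclotomic_prime:
  fixes n :: nat
  assumes "prime n"
  shows "irreducible (\<Sum>k<n. monom 1 k :: int poly)" (is "irreducible ?\<phi>")
    and "degree (\<Sum>k<n. monom 1 k :: int poly) = n - 1"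
proof -
  have n2: "n \<ge> 2" using assms prime_ge_2_nat by blast
  have c\<phi>: "coeff ?\<phi> k = (if k < n then 1 else 0)" for k by (simp add: coeff_sum)
  show deg: "degree ?\<phi> = n - 1"
    by (rule antisym[OF degree_le le_degree]) (use n2 in \<open>auto simp: c\<phi>\<close>)
  define E where "E = pcompose ?\<phi> [:1, 1:]"
  have geom: "[:-1, 1:] * ?\<phi> = monom 1 n - 1"
  proof (induction n)
    case (Suc n)
    have "[:-1, 1:] * (\<Sum>k<Suc n. monom 1 k :: int poly)
        = [:-1, 1:] * (\<Sum>k<n. monom 1 k) + [:-1, 1:] * monom 1 n" by (simp add: distrib_left)
    also have "[:-1, 1:] * monom 1 n = monom 1 (Suc n) - (monom 1 n :: int poly)"
      by (simp add: monom_Suc algebra_simps)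
    finally show ?case using Suc by simp
  qed simp
  have monom_shift: "pcompose (monom 1 k) [:1, 1:] = [:1, 1 :: int:] ^ k" for k
    by (induction k) (simp_all add: monom_Suc pcompose_pCons)
  have "pcompose ([:-1, 1:] * ?\<phi>) [:1, 1:] = [:0, 1:] * E"
    unfolding E_def pcompose_mult by (simp add: pcompose_pCons)
  hence shift: "[:0, 1:] * E = [:1, 1:] ^ n - 1"
    unfolding geom pcompose_diff pcompose_1 monom_shift by (rule sym)
  have cE: "coeff E k = int (n choose Suc k)" for k
  proof -
    have "coeff E k = coeff ([:0, 1:] * E) (Suc k)" by simp
    also have "\<dots> = int (n choose Suc k)" unfolding shift using coeff_linear_poly_power[of "Suc k" n "1::int" 1]
      by (cases "Suc k \<le> n") (auto simp: coeff_eq_0 degree_linear_power binomial_eq_0)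
    finally show ?thesis .
  qed
  have dE: "degree E = n - 1" unfolding E_def by (simp add: degree_pcompose deg)
  have "irreducible E"
  proof (rule eisenstein)
    show "prime (int n)" using assms by simp
    show "degree E > 0" using dE n2 by simp
    show "lead_coeff E = 1" using n2 by (simp add: dE cE)
    show "int n dvd coeff E i" if "i < degree E" for i
      using that assms dE by (auto simp: cE intro!: dvd_choose_prime)
    show "\<not> (int n)\<^sup>2 dvd coeff E 0"
    proof
      assume "(int n)\<^sup>2 dvd coeff E 0"
      hence "n\<^sup>2 dvd n" by (simp add: cE flip: of_nat_power)
      hence "n\<^sup>2 \<le> n" using n2 by (intro dvd_imp_le) auto
      thus False using n2 by (simp add: power2_eq_square)
    qed
  qed
  thus "irreducible ?\<phi>" unfolding E_def by (rule irreducible_if_irreducible_shift)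
qed

text \<open>
  A polynomial of least degree vanishing at \<open>z\<close> divides an integer multiple of \<open>P\<close>, by
  pseudo-division. As \<open>P\<close> is a prime element, it divides that minimal polynomial or the cofactor, and
  the cofactor has too small a degree.
\<close>
lemma irreducible_int_poly_minimal_degree:
  fixes P q :: "int poly" and z :: "'a :: field_char_0"
  assumes irr: "irreducible P" 
    and rP: "poly (map_poly of_int P) z = 0"
    and rq: "poly (map_poly of_int q) z = 0" and q: "q \<noteq> 0"
  shows "degree P \<le> degree q"
proof -
  let ?v = "\<lambda>r :: int poly. poly (map_poly of_int r) z"
  have v_mult: "?v (r * s) = ?v r * ?v s" and v_add: "?v (r + s) = ?v r + ?v s" for r s
    by (simp_all add: of_int_poly_hom.hom_mult of_int_poly_hom.hom_add)
  define r where "r = (ARG_MIN degree r. r \<noteq> 0 \<and> ?v r = 0)"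
  have "r \<noteq> 0 \<and> ?v r = 0" and min: "degree r \<le> degree s" if "s \<noteq> 0" "?v s = 0" for s
    unfolding r_def using arg_min_nat_lemma[of "\<lambda>r. r \<noteq> 0 \<and> ?v r = 0" s degree] that by auto
  hence r: "r \<noteq> 0" "?v r = 0" using q rq by blast+
  obtain s t where st: "pseudo_divmod P r = (s, t)" by force
  define c where "c = lead_coeff r ^ (Suc (degree P) - degree r)"
  have eq: "smult c P = r * s + t" and t: "t = 0 \<or> degree t < degree r"
    using pseudo_divmod[OF r(1) st] by (auto simp: c_def)
  have "?v (smult c P) = 0" using rP v_mult[of "[:c:]" P] by simp
  hence "?v t = 0" using eq r(2) v_mult[of r s] v_add[of "r * s" t] by simp
  hence "t = 0" using t min[of t] by fastforce
  hence eq: "smult c P = r * s" using eq by simp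
  have c: "c \<noteq> 0" using r(1) by (simp add: c_def)
  have P: "P \<noteq> 0" using irr by auto
  have s: "s \<noteq> 0" using eq c P by auto
  have dP: "degree P = degree r + degree s"
    using arg_cong[OF eq, of degree] c r(1) s by (simp add: degree_mult_eq)
  have dr: "degree r > 0"
  proof (rule ccontr)
    assume "\<not> ?thesis"
    then obtain a where "r = [:a:]" by (auto elim: degree_eq_zeroE)
    thus False using r by simp
  qed
  have "P dvd r * s" using eq by (metis dvd_smult dvd_refl)
  hence "P dvd r \<or> P dvd s"
    using irreducible_imp_prime_poly[OF irr] by (simp add: prime_elem_dvd_mult_iff)
  moreover have "\<not> P dvd s" using dvd_imp_degree_le[of P s] s dP dr by auto
  ultimately have "degree P \<le> degree r" using r(1) by (auto dest: dvd_imp_degree_le)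
  also have "\<dots> \<le> degree q" using min q rq .
  finally show ?thesis .
qed

text \<open>
  The relation \<open>1 + w + \<dots> + w\<^sup>n\<^sup>-\<^sup>1 = 0\<close> is, up to a factor, the only one: subtracting
  \<open>m (n - 1)\<close> times it leaves a polynomial of degree below \<open>n - 1\<close> that vanishes at \<open>w\<close>,
  which irreducibility of the cyclotomic polynomial forces to be zero.
\<close>
lemma integer_relation_roots_of_unity_prime:
  fixes m :: "nat \<Rightarrow> int" and w :: "'a :: field_char_0"
  assumes n: "prime n" and w: "w ^ n = 1" "w \<noteq> 1"
    and rel: "(\<Sum>k<n. of_int (m k) * w ^ k) = 0" and k: "k < n"
  shows "m k = m 0"
proof -
  have n2: "n \<ge> 2" using n prime_ge_2_nat by blast
  have eval: "poly (map_poly of_int (\<Sum>k<n. monom (a k) k)) w = (\<Sum>k<n. of_int (a k) * w ^ k)" for a :: "nat \<Rightarrow> int"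
    by (simp add: of_int_poly_hom.hom_sum poly_sum poly_monom)
  have sum0: "(\<Sum>k<n. w ^ k) = 0"
    using w by (simp add: geometric_sum)
  let ?\<phi> = "\<Sum>k<n. monom 1 k :: int poly"
  define q where "q = (\<Sum>k<n. monom (m k - m (n - 1)) k)"
  have cq: "coeff q k = (if k < n then m k - m (n - 1) else 0)" for k
    by (simp add: q_def coeff_sum)
  have "poly (map_poly of_int q) w = (\<Sum>k<n. of_int (m k) * w ^ k) - of_int (m (n - 1)) * (\<Sum>k<n. w ^ k)"
    unfolding q_def eval by (simp add: left_diff_distrib sum_subtractf sum_distrib_left)
  hence qw: "poly (map_poly of_int q) w = 0" using rel sum0 by simp
  have "q = 0"
  proof (rule ccontr)
    assume q: "q \<noteq> 0"
    have "degree ?\<phi> \<le> degree q"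
      by (rule irreducible_int_poly_minimal_degree[OF irreducible_cyclotomic_prime(1)[OF n] _ qw q])
         (use eval[of "\<lambda>_. 1"] sum0 in simp)
    hence "n - 1 \<le> degree q" by (simp add: irreducible_cyclotomic_prime(2)[OF n])
    moreover have "lead_coeff q \<noteq> 0" using q by simp
    ultimately show False using cq[of "degree q"] n2 by (cases "degree q = n - 1") (auto split: if_splits)
  qed
  thus ?thesis using cq[of k] cq[of 0] k by (auto split: if_splits)
qed

section \<open>Substitution as a ring homomorphism\<close>

lemma pconst_0 [simp]: "pconst 0 = 0" and pconst_1 [simp]: "pconst 1 = 1"
  by (simp_all add: pconst_def)

lemma pconst_add: "pconst (a + b) = pconst a + pconst b"
  by (simp add: pconst_def single_add)

lemma pconst_mult: "pconst (a * b) = pconst a * pconst b"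
  by (simp add: pconst_def mult_single)

lemma pconst_diff: "pconst (a - b) = pconst a - pconst b"
  by (simp add: pconst_def single_diff)

lemma pconst_sum: "pconst (sum a I) = (\<Sum>i\<in>I. pconst (a i))"
  by (induction I rule: infinite_finite_induct) (simp_all add: pconst_add)

lemma pconst_power: "pconst (a ^ k) = pconst a ^ k"
  by (induction k) (simp_all add: pconst_mult)

lemma pconst_prod: "pconst (prod a I) = (\<Prod>i\<in>I. pconst (a i))"
  by (induction I rule: infinite_finite_induct) (simp_all add: pconst_mult)

lemma cpoly_sum_singles:
  fixes f :: cpoly
  shows "f = (\<Sum>m\<in>Poly_Mapping.keys f. Poly_Mapping.single m (Poly_Mapping.lookup f m))"
  by (rule poly_mapping_eqI)
     (auto simp: lookup_sum lookup_single when_def in_keys_iff intro: sum.neutral)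

lemma cpoly_induct [case_names single add]:
  fixes f :: cpoly
  assumes "\<And>m c. P (Poly_Mapping.single m c)" and add: "\<And>f g. P f \<Longrightarrow> P g \<Longrightarrow> P (f + g)"
  shows "P f"
proof -
  have "P 0" using assms(1)[of 0 0] by simp
  hence "P (\<Sum>m\<in>K. Poly_Mapping.single m (Poly_Mapping.lookup f m))" for K
    by (induction K rule: infinite_finite_induct) (auto intro: assms)
  thus ?thesis by (subst cpoly_sum_singles)
qed

definition pmonom :: "(nat \<Rightarrow> cpoly) \<Rightarrow> (nat \<Rightarrow>\<^sub>0 nat) \<Rightarrow> cpoly" where
  "pmonom y m = (\<Prod>i\<in>Poly_Mapping.keys m. y i ^ Poly_Mapping.lookup m i)"

lemma pmonom_superset:
  "finite K \<Longrightarrow> Poly_Mapping.keys m \<subseteq> K \<Longrightarrow> pmonom y m = (\<Prod>i\<in>K. y i ^ Poly_Mapping.lookup m i)"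
  unfolding pmonom_def by (rule prod.mono_neutral_left) (auto simp: in_keys_iff)

lemma pmonom_0 [simp]: "pmonom y 0 = 1"
  by (simp add: pmonom_def)

lemma pmonom_add: "pmonom y (m + m') = pmonom y m * pmonom y m'"
proof -
  let ?K = "Poly_Mapping.keys m \<union> Poly_Mapping.keys m'"
  have "pmonom y (m + m') = (\<Prod>i\<in>?K. y i ^ Poly_Mapping.lookup (m + m') i)"
    by (rule pmonom_superset) (auto simp: keys_add)
  also have "\<dots> = (\<Prod>i\<in>?K. y i ^ Poly_Mapping.lookup m i) * (\<Prod>i\<in>?K. y i ^ Poly_Mapping.lookup m' i)"
    by (simp add: lookup_add power_add prod.distrib)
  also have "\<dots> = pmonom y m * pmonom y m'"
    by (simp add: pmonom_superset[of ?K])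
  finally show ?thesis .
qed

lemma psubst_alt: "psubst g f = (\<Sum>m\<in>Poly_Mapping.keys f. pconst (Poly_Mapping.lookup f m) * pmonom g m)"
  by (simp add: psubst_def pmonom_def)

lemma psubst_single [simp]: "psubst g (Poly_Mapping.single m c) = pconst c * pmonom g m"
  by (simp add: psubst_alt)

lemma psubst_0 [simp]: "psubst g 0 = 0"
  by (simp add: psubst_def)

lemma psubst_add: "psubst g (f + h) = psubst g f + psubst g h"
  unfolding psubst_alt by (rule setsum_keys_plus_distrib) (simp_all add: pconst_add distrib_right)

lemma psubst_mult: "psubst g (f * h) = psubst g f * psubst g h"
proof (induction f rule: cpoly_induct)
  case (single m c)
  show ?case
    by (induction h rule: cpoly_induct)
       (simp_all add: psubst_add mult_single pconst_mult pmonom_add distrib_left algebra_simps)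
qed (simp add: distrib_right psubst_add)

lemma psubst_pconst [simp]: "psubst g (pconst c) = pconst c"
  by (simp add: pconst_def[of c])

lemma psubst_pvar [simp]: "psubst g (pvar i) = g i"
  by (simp add: pvar_def pmonom_def)

lemma psubst_sum: "psubst g (sum f I) = (\<Sum>i\<in>I. psubst g (f i))"
  by (induction I rule: infinite_finite_induct) (simp_all add: psubst_add)

lemma psubst_1 [simp]: "psubst g 1 = 1"
  using psubst_pconst[of g 1] by simp

lemma psubst_power: "psubst g (f ^ k) = psubst g f ^ k"
  by (induction k) (simp_all add: psubst_mult)

lemma psubst_prod: "psubst g (prod f I) = (\<Prod>i\<in>I. psubst g (f i))"
  by (induction I rule: infinite_finite_induct) (simp_all add: psubst_mult)

lemma psubst_pmonom: "psubst h (pmonom g m) = pmonom (\<lambda>i. psubst h (g i)) m"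
  by (simp add: pmonom_def psubst_prod psubst_power)

lemma psubst_psubst: "psubst h (psubst g f) = psubst (\<lambda>i. psubst h (g i)) f"
  by (simp add: psubst_alt[of _ f] psubst_sum psubst_mult psubst_pmonom)

lemma pmonom_pvar: "pmonom pvar m = Poly_Mapping.single m 1"
proof -
  have power: "pvar i ^ e = Poly_Mapping.single (Poly_Mapping.single i e) 1" for i e
    by (induction e) (simp_all add: pvar_def mult_single flip: single_add)
  have prod: "(\<Prod>i\<in>K. Poly_Mapping.single (u i) 1 :: cpoly) = Poly_Mapping.single (\<Sum>i\<in>K. u i) 1"
    for K and u :: "nat \<Rightarrow> nat \<Rightarrow>\<^sub>0 nat"
    by (induction K rule: infinite_finite_induct) (simp_all add: mult_single)
  have "(\<Sum>i\<in>Poly_Mapping.keys m. Poly_Mapping.single i (Poly_Mapping.lookup m i)) = m"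
    by (rule poly_mapping_eqI)
       (auto simp: lookup_sum lookup_single when_def in_keys_iff intro: sum.neutral)
  thus ?thesis by (simp add: pmonom_def power prod)
qed

lemma psubst_pvar_id [simp]: "psubst pvar f = f"
  by (induction f rule: cpoly_induct) (simp_all add: psubst_add pmonom_pvar pconst_def mult_single)

section \<open>Closure properties of the polynomial ring\<close>

lemma poly_ringI: "(\<And>m. m \<in> Poly_Mapping.keys f \<Longrightarrow> Poly_Mapping.keys m \<subseteq> {..<n}) \<Longrightarrow> f \<in> poly_ring n"
  by (simp add: poly_ring_def)

lemma poly_ringD: "f \<in> poly_ring n \<Longrightarrow> m \<in> Poly_Mapping.keys f \<Longrightarrow> Poly_Mapping.keys m \<subseteq> {..<n}"
  by (simp add: poly_ring_def)

lemma poly_ring_pconst: "pconst c \<in> poly_ring n"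
  by (rule poly_ringI) (auto simp: pconst_def split: if_splits)

lemma poly_ring_pvar: "i < n \<Longrightarrow> pvar i \<in> poly_ring n"
  by (rule poly_ringI) (auto simp: pvar_def)

lemma poly_ring_add: "f \<in> poly_ring n \<Longrightarrow> g \<in> poly_ring n \<Longrightarrow> f + g \<in> poly_ring n"
  using keys_add[of f g] by (auto simp: poly_ring_def)

lemma poly_ring_mult: 
  assumes "f \<in> poly_ring n" "g \<in> poly_ring n"
  shows "f * g \<in> poly_ring n"
proof (rule poly_ringI)
  fix m assume "m \<in> Poly_Mapping.keys (f * g)"
  then obtain a b where "m = a + b" "a \<in> Poly_Mapping.keys f" "b \<in> Poly_Mapping.keys g"
    using keys_mult[of f g] by blast
  thus "Poly_Mapping.keys m \<subseteq> {..<n}"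
    using keys_add[of a b] assms[THEN poly_ringD] by blast
qed

lemma poly_ring_sum: "(\<And>i. i \<in> I \<Longrightarrow> f i \<in> poly_ring n) \<Longrightarrow> sum f I \<in> poly_ring n"
  by (induction I rule: infinite_finite_induct)
     (auto intro: poly_ring_add poly_ring_pconst[of 0, simplified])

lemma poly_ring_power: "f \<in> poly_ring n \<Longrightarrow> f ^ k \<in> poly_ring n"
  by (induction k) (auto intro: poly_ring_mult poly_ring_pconst[of 1, simplified])

lemma poly_ring_prod: "(\<And>i. i \<in> I \<Longrightarrow> f i \<in> poly_ring n) \<Longrightarrow> prod f I \<in> poly_ring n"
  by (induction I rule: infinite_finite_induct)
     (auto intro: poly_ring_mult poly_ring_pconst[of 1, simplified])

lemma poly_ring_psubst:
  assumes "f \<in> poly_ring n" "\<And>i. i < n \<Longrightarrow> g i \<in> poly_ring k"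
  shows "psubst g f \<in> poly_ring k"
  unfolding psubst_def
  by (intro poly_ring_sum poly_ring_mult poly_ring_pconst poly_ring_prod poly_ring_power assms(2))
     (use poly_ringD[OF assms(1)] in blast)

lemma psubst_cong:
  assumes "f \<in> poly_ring n" "\<And>i. i < n \<Longrightarrow> g i = h i"
  shows "psubst g f = psubst h f"
  unfolding psubst_def using poly_ringD[OF assms(1)] assms(2)
  by (intro sum.cong refl arg_cong2[where f = "(*)"] prod.cong) (auto simp: subset_iff)

section \<open>Linear changes of variables\<close>

definition lform :: "nat \<Rightarrow> (nat \<Rightarrow> complex) \<Rightarrow> cpoly" where
  "lform n a = (\<Sum>j<n. pconst (a j) * pvar j)"

lemma mat_act_alt: "mat_act A f = psubst (\<lambda>i. lform (dim_col A) (\<lambda>j. A $$ (i, j))) f"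
  by (simp add: mat_act_def lform_def)

lemma lform_cong: "(\<And>j. j < n \<Longrightarrow> a j = b j) \<Longrightarrow> lform n a = lform n b"
  by (simp add: lform_def)

lemma lform_delta: "i < n \<Longrightarrow> lform n (\<lambda>j. if j = i then 1 else 0) = pvar i"
  by (simp add: lform_def if_distrib[of pconst] if_distrib[of "\<lambda>x. x * _"] cong: if_cong)

lemma lform_scale: "lform n (\<lambda>j. c * a j) = pconst c * lform n a"
  by (simp add: lform_def sum_distrib_left pconst_mult mult.assoc)

lemma poly_ring_lform: "lform n a \<in> poly_ring n"
  unfolding lform_def by (intro poly_ring_sum poly_ring_mult poly_ring_pconst poly_ring_pvar) auto

lemma psubst_lform: "psubst g (lform n a) = (\<Sum>k<n. pconst (a k) * g k)"
  by (simp add: lform_def psubst_sum psubst_mult)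

lemma psubst_lform_lform:
  "psubst (\<lambda>k. lform n (b k)) (lform n a) = lform n (\<lambda>l. \<Sum>k<n. a k * b k l)"
proof -
  have "psubst (\<lambda>k. lform n (b k)) (lform n a) = (\<Sum>k<n. \<Sum>l<n. pconst (a k * b k l) * pvar l)"
    by (simp add: psubst_lform) (simp add: lform_def sum_distrib_left pconst_mult mult.assoc)
  also have "\<dots> = lform n (\<lambda>l. \<Sum>k<n. a k * b k l)"
    by (subst sum.swap) (simp add: lform_def pconst_sum sum_distrib_right)
  finally show ?thesis .
qed

lemma psubst_inverse_lforms:
  assumes inv: "\<And>i l. i < n \<Longrightarrow> l < n \<Longrightarrow> (\<Sum>k<n. a i k * b k l) = (if l = i then 1 else 0)"
    and f: "f \<in> poly_ring n"
  shows "psubst (\<lambda>k. lform n (b k)) (psubst (\<lambda>i. lform n (a i)) f) = f"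
proof -
  have "psubst (\<lambda>k. lform n (b k)) (lform n (a i)) = pvar i" if "i < n" for i
  proof -
    have "psubst (\<lambda>k. lform n (b k)) (lform n (a i)) = lform n (\<lambda>l. if l = i then 1 else 0)"
      unfolding psubst_lform_lform by (rule lform_cong) (rule inv[OF that])
    thus ?thesis by (simp only: lform_delta[OF that])
  qed
  hence "psubst (\<lambda>i. psubst (\<lambda>k. lform n (b k)) (lform n (a i))) f = psubst pvar f"
    by (rule psubst_cong[OF f])
  thus ?thesis by (simp only: psubst_psubst psubst_pvar_id)
qed

section \<open>Derivations\<close>

definition derivation :: "(cpoly \<Rightarrow> cpoly) \<Rightarrow> bool" where
  "derivation L \<longleftrightarrow> (\<forall>f g. L (f + g) = L f + L g) \<and> (\<forall>f g. L (f * g) = L f * g + f * L g) \<and> 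
     (\<forall>c. L (pconst c) = 0)"

lemma pderiv_wrt_add: "pderiv_wrt i (f + g) = pderiv_wrt i f + pderiv_wrt i g"
  unfolding pderiv_wrt_def by (rule setsum_keys_plus_distrib) (simp_all add: distrib_left single_add)

lemma pderiv_wrt_single:
  "pderiv_wrt i (Poly_Mapping.single m c) =
     Poly_Mapping.single (m - Poly_Mapping.single i 1) (of_nat (Poly_Mapping.lookup m i) * c)"
  by (simp add: pderiv_wrt_def)

lemma pderiv_wrt_mult: "pderiv_wrt i (f * g) = pderiv_wrt i f * g + f * pderiv_wrt i g"
proof (induction f rule: cpoly_induct)
  case (single m c)
  show ?case
  proof (induction g rule: cpoly_induct)
    case (single m' d)
    define e :: "nat \<Rightarrow>\<^sub>0 nat" where "e = Poly_Mapping.single i 1"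
    have pderiv: "pderiv_wrt i (Poly_Mapping.single m c)
        = Poly_Mapping.single (m - e) (of_nat (Poly_Mapping.lookup m i) * c)" for m c
      by (simp add: pderiv_wrt_single e_def)
    (* Truncated subtraction of e commutes with adding m' only if x_i occurs in m;
       otherwise the coefficient of the term in question is 0. *)
    have left: "m - e + m' = m + m' - e" if "Poly_Mapping.lookup m i \<noteq> 0" for m m'
      by (rule poly_mapping_eqI) (use that in \<open>auto simp: e_def lookup_add lookup_minus lookup_single when_def\<close>)
    have L: "Poly_Mapping.single (m - e + m') (of_nat (Poly_Mapping.lookup m i) * (c * d))
        = Poly_Mapping.single (m + m' - e) (of_nat (Poly_Mapping.lookup m i) * (c * d))"
      using left[of m m'] by (cases "Poly_Mapping.lookup m i = 0") simp_all
    have R: "Poly_Mapping.single (m + (m' - e)) (c * (of_nat (Poly_Mapping.lookup m' i) * d))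
        = Poly_Mapping.single (m + m' - e) (c * (of_nat (Poly_Mapping.lookup m' i) * d))"
      using left[of m' m] by (cases "Poly_Mapping.lookup m' i = 0") (simp_all add: add.commute)
    show ?case
      by (simp add: mult_single pderiv L R lookup_add mult.assoc flip: single_add)
         (simp add: algebra_simps)
  qed (simp add: pderiv_wrt_add distrib_left algebra_simps)
qed (simp add: pderiv_wrt_add distrib_right algebra_simps)

lemma pderiv_wrt_pconst [simp]: "pderiv_wrt i (pconst c) = 0"
  by (simp add: pconst_def pderiv_wrt_single)

lemma pderiv_wrt_pvar: "pderiv_wrt i (pvar j) = (if i = j then 1 else 0)"
  by (simp add: pvar_def pderiv_wrt_single lookup_single when_def)

definition vector_field :: "nat \<Rightarrow> (nat \<Rightarrow> cpoly) \<Rightarrow> cpoly \<Rightarrow> cpoly" where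
  "vector_field n v f = (\<Sum>i<n. v i * pderiv_wrt i f)"

lemma derivation_vector_field: "derivation (vector_field n v)"
  by (auto simp: derivation_def vector_field_def pderiv_wrt_add pderiv_wrt_mult 
      sum.distrib sum_distrib_left sum_distrib_right algebra_simps)

lemma vector_field_pvar: "j < n \<Longrightarrow> vector_field n v (pvar j) = v j"
  by (simp add: vector_field_def pderiv_wrt_pvar if_distrib[of "\<lambda>x. _ * x"] cong: if_cong)

lemma derivation_sum:
  assumes "derivation L" shows "L (sum f I) = (\<Sum>i\<in>I. L (f i))"
proof -
  have "L 0 = 0" using assms unfolding derivation_def by (metis pconst_0)
  thus ?thesis using assms by (induction I rule: infinite_finite_induct) (auto simp: derivation_def)
qed

lemma derivation_pconst_mult: "derivation L \<Longrightarrow> L (pconst c * f) = pconst c * L f"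
  by (simp add: derivation_def)

text \<open>
  Logarithmic differentiation: a derivation acting on each \<open>y\<^sub>k\<close> by a scalar acts on a monomial in
  the \<open>y\<^sub>k\<close> by the sum of these scalars weighted with the exponents.
\<close>
lemma derivation_eigen_pmonom:
  assumes L: "derivation L"
    and eig: "\<And>k. k \<in> Poly_Mapping.keys m \<Longrightarrow> L (y k) = pconst (l k) * y k"
  shows "L (pmonom y m) = pconst (\<Sum>k\<in>Poly_Mapping.keys m. of_nat (Poly_Mapping.lookup m k) * l k) * pmonom y m"
proof -
  have L1: "L 1 = 0" using L unfolding derivation_def by (metis pconst_1)
  have Lmult: "L (f * g) = L f * g + f * L g" for f g using L by (simp add: derivation_def)
  have pow: "L (y k ^ e) = pconst (of_nat e * l k) * y k ^ e" if "k \<in> Poly_Mapping.keys m" for k e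
    by (induction e) (simp_all add: L1 Lmult eig[OF that] pconst_add algebra_simps)
  have "L (\<Prod>k\<in>K. y k ^ Poly_Mapping.lookup m k)
      = pconst (\<Sum>k\<in>K. of_nat (Poly_Mapping.lookup m k) * l k) * (\<Prod>k\<in>K. y k ^ Poly_Mapping.lookup m k)"
    if "finite K" "K \<subseteq> Poly_Mapping.keys m" for K
    using that by (induction K rule: finite_induct) (simp_all add: L1 Lmult pow pconst_add algebra_simps)
  thus ?thesis unfolding pmonom_def by simp
qed

section \<open>Operators that are diagonal on monomials\<close>

text \<open>
  The common principle behind the differential operators and the group action: if the monomials in
  \<open>y\<close> are eigenvectors of an additive map, then the coefficients of its value on a polynomial in \<open>y\<close>
  are those of the polynomial, multiplied by the eigenvalues. The kernel can be read off monomial by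
  monomial, because distinct monomials in \<open>y\<close> are linearly independent.
\<close>
lemma diagonal_operator_psubst_eq_0_iff:
  fixes T :: "cpoly \<Rightarrow> cpoly" and ev :: "(nat \<Rightarrow>\<^sub>0 nat) \<Rightarrow> complex"
  assumes T: "\<And>f h. T (f + h) = T f + T h"
    and inj: "\<And>h. h \<in> poly_ring n \<Longrightarrow> psubst y h = 0 \<Longrightarrow> h = 0"
    and ev: "\<And>m c. Poly_Mapping.keys m \<subseteq> {..<n} \<Longrightarrow>
               T (pconst c * pmonom y m) = pconst (ev m) * (pconst c * pmonom y m)"
    and g: "g \<in> poly_ring n"
  shows "T (psubst y g) = 0 \<longleftrightarrow> (\<forall>m\<in>Poly_Mapping.keys g. ev m = 0)"
proof -
  have "T 0 = 0" using T[of 0 0] by simp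
  hence Tsum: "T (sum f I) = (\<Sum>i\<in>I. T (f i))" for I and f :: "(nat \<Rightarrow>\<^sub>0 nat) \<Rightarrow> cpoly"
    using T by (induction I rule: infinite_finite_induct) auto
  define h :: cpoly where
    "h = (\<Sum>m\<in>Poly_Mapping.keys g. Poly_Mapping.single m (ev m * Poly_Mapping.lookup g m))"
  have lookup_h: "Poly_Mapping.lookup h m = ev m * Poly_Mapping.lookup g m" for m
    by (auto simp: h_def lookup_sum lookup_single when_def in_keys_iff intro: sum.neutral)
  have h: "h \<in> poly_ring n"
    using g by (auto simp: poly_ring_def in_keys_iff lookup_h)
  have "T (psubst y g) = (\<Sum>m\<in>Poly_Mapping.keys g. T (pconst (Poly_Mapping.lookup g m) * pmonom y m))"
    by (simp add: psubst_alt Tsum)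
  also have "\<dots> = (\<Sum>m\<in>Poly_Mapping.keys g. pconst (ev m * Poly_Mapping.lookup g m) * pmonom y m)"
    by (intro sum.cong refl) (simp add: ev poly_ringD[OF g] pconst_mult mult.assoc)
  also have "\<dots> = psubst y h" by (simp add: h_def psubst_sum)
  finally have "T (psubst y g) = 0 \<longleftrightarrow> h = 0" using inj[OF h] by auto
  also have "\<dots> \<longleftrightarrow> (\<forall>m\<in>Poly_Mapping.keys g. ev m = 0)"
    by (auto simp: poly_mapping_eq_iff fun_eq_iff lookup_h in_keys_iff)
  finally show ?thesis .
qed

section \<open>The discrete Fourier transform\<close>

definition primitive_root_of_unity :: "nat \<Rightarrow> complex \<Rightarrow> bool" where
  "primitive_root_of_unity n w \<longleftrightarrow> n > 0 \<and> w ^ n = 1 \<and> (\<forall>k. 0 < k \<and> k < n \<longrightarrow> w ^ k \<noteq> 1)"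

lemma primitive_root_of_unity_exists:
  assumes "n > 0"
  shows "\<exists>w. primitive_root_of_unity n w"
proof -
  let ?f = "\<lambda>k. cis (2 * pi * real k / real n)"
  have bij: "bij_betw ?f {..<n} {z. z ^ n = 1}" by (rule bij_betw_roots_unity[OF assms])
  have pow: "?f k = cis (2 * pi / real n) ^ k" for k by (simp add: DeMoivre mult_ac)
  have "cis (2 * pi / real n) ^ k \<noteq> 1" if "0 < k" "k < n" for k
  proof
    assume "cis (2 * pi / real n) ^ k = 1"
    hence "?f k = ?f 0" by (simp add: pow)
    with bij_betw_imp_inj_on[OF bij] have "k = 0"
      by (rule inj_onD) (use that assms in auto)
    thus False using that by simp
  qed
  moreover have "cis (2 * pi / real n) ^ n = 1" using assms by (simp add: DeMoivre)
  ultimately show ?thesis using assms unfolding primitive_root_of_unity_def by blast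
qed

lemma root_of_unity_power_mod:
  fixes w :: "'a :: monoid_mult"
  assumes "w ^ n = 1"
  shows "w ^ (k mod n) = w ^ k"
proof -
  have "w ^ k = w ^ (k mod n + n * (k div n))" by simp
  also have "\<dots> = w ^ (k mod n)" unfolding power_add power_mult assms by simp
  finally show ?thesis by simp
qed

lemma root_of_unity_orthogonality:
  assumes w: "primitive_root_of_unity n w" and kl: "k < n" "l < n"
  shows "(\<Sum>j<n. w ^ (k * j) * inverse w ^ (j * l)) = (if l = k then of_nat n else 0)"
proof -
  have wn: "w ^ n = 1" and n: "n > 0" and prim: "\<And>k. 0 < k \<Longrightarrow> k < n \<Longrightarrow> w ^ k \<noteq> 1"
    using w by (auto simp: primitive_root_of_unity_def)
  have w0: "w \<noteq> 0" using wn n by (auto simp: power_0_left)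
  define z where "z = w ^ k * inverse w ^ l"
  have sum: "(\<Sum>j<n. w ^ (k * j) * inverse w ^ (j * l)) = (\<Sum>j<n. z ^ j)"
    by (simp add: z_def power_mult power_mult_distrib mult.commute[of _ l])
  have inj: "a = b" if "w ^ a = w ^ b" "a \<le> b" "b < n" for a b
  proof (rule ccontr)
    assume "a \<noteq> b"
    have "w ^ b = w ^ a * w ^ (b - a)" using that(2) by (simp flip: power_add)
    hence "w ^ (b - a) = 1" using that(1) w0 by simp
    thus False using prim[of "b - a"] \<open>a \<noteq> b\<close> that by simp
  qed
  show ?thesis
  proof (cases "l = k")
    case True
    hence "z = 1" using w0 by (simp add: z_def power_inverse)
    thus ?thesis using True sum by simp
  next
    case False
    have "z \<noteq> 1"
    proof
      assume "z = 1"
      hence "w ^ k = w ^ l" using w0 by (simp add: z_def field_simps)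
      thus False using inj[of k l] inj[of l k] kl False by (cases "k \<le> l") auto
    qed
    moreover have "z ^ n = 1"
    proof -
      have "z ^ n = (w ^ n) ^ k * inverse (w ^ n) ^ l"
        unfolding z_def power_mult_distrib power_inverse by (simp only: mult.commute flip: power_mult)
      thus ?thesis by (simp add: wn)
    qed
    ultimately have "(\<Sum>j<n. z ^ j) = 0" by (simp add: geometric_sum)
    thus ?thesis using False sum by simp
  qed
qed

text \<open>
  The linear forms \<open>y\<^sub>k\<close> that simultaneously diagonalise all circulant matrices.
\<close>
definition dft_form :: "nat \<Rightarrow> complex \<Rightarrow> nat \<Rightarrow> cpoly" where
  "dft_form n w k = lform n (\<lambda>j. w ^ (k * j))"

lemma primitive_root_of_unity_inverse:
  assumes "primitive_root_of_unity n w"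
  shows "primitive_root_of_unity n (inverse w)"
  using assms by (auto simp: primitive_root_of_unity_def power_inverse)

text \<open>
  By orthogonality the forms \<open>n\<inverse> \<Sum>\<^sub>k w\<^sup>-\<^sup>j\<^sup>k x\<^sub>k\<close> invert the substitution of the Fourier forms on both
  sides, so the Fourier forms are just another system of coordinates of the polynomial ring.
\<close>
lemma
  assumes w: "primitive_root_of_unity n w" and f: "f \<in> poly_ring n"
  shows psubst_dft_form_surj: "\<exists>g\<in>poly_ring n. f = psubst (dft_form n w) g"
    and psubst_dft_form_inj: "psubst (dft_form n w) f = 0 \<Longrightarrow> f = 0"
proof -
  have n: "n > 0" using w by (simp add: primitive_root_of_unity_def)
  define c where "c j k = inverse (of_nat n) * inverse w ^ (j * k)" for j k
  have y: "dft_form n w = (\<lambda>k. lform n (\<lambda>j. w ^ (k * j)))" by (rule ext) (rule dft_form_def)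
  have iw: "primitive_root_of_unity n (inverse w)" by (rule primitive_root_of_unity_inverse[OF w])
  have 1: "(\<Sum>k<n. c i k * w ^ (k * l)) = (if l = i then 1 else 0)" if "i < n" "l < n" for i l
    using root_of_unity_orthogonality[OF iw that] n
    by (simp add: c_def mult.assoc flip: sum_distrib_left)
  have 2: "(\<Sum>k<n. w ^ (i * k) * c k l) = (if l = i then 1 else 0)" if "i < n" "l < n" for i l
    using root_of_unity_orthogonality[OF w that] n
    by (simp add: c_def mult.left_commute flip: sum_distrib_left)
  let ?g = "psubst (\<lambda>j. lform n (c j)) f"
  have "?g \<in> poly_ring n" by (rule poly_ring_psubst[OF f]) (rule poly_ring_lform)
  moreover have "psubst (dft_form n w) ?g = f"
    unfolding y by (rule psubst_inverse_lforms[OF 1 f])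
  ultimately show "\<exists>g\<in>poly_ring n. f = psubst (dft_form n w) g" by metis
  have "psubst (\<lambda>j. lform n (c j)) (psubst (dft_form n w) f) = f"
    unfolding y by (rule psubst_inverse_lforms[OF 2 f])
  thus "f = 0" if "psubst (dft_form n w) f = 0" using that by simp
qed

text \<open>
  Covers both cyclic shifts at once: shifting the indices down by one satisfies the hypothesis with
  \<open>c = w\<close>, shifting them up by one with \<open>c = w\<inverse>\<close>.
\<close>
lemma vector_field_dft_form:
  assumes \<sigma>: "bij_betw \<sigma> {..<n} {..<n}" and c: "\<And>j. j < n \<Longrightarrow> w ^ j = c * w ^ \<sigma> j"
  shows "vector_field n (\<lambda>i. pvar (\<sigma> i)) (dft_form n w k) = pconst (c ^ k) * dft_form n w k"
proof -
  let ?L = "vector_field n (\<lambda>i. pvar (\<sigma> i))"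
  have "?L (dft_form n w k) = (\<Sum>j<n. pconst (w ^ (k * j)) * pvar (\<sigma> j))"
    by (simp add: dft_form_def lform_def derivation_sum derivation_pconst_mult
        derivation_vector_field vector_field_pvar)
  also have "\<dots> = (\<Sum>j<n. pconst (c ^ k * w ^ (k * \<sigma> j)) * pvar (\<sigma> j))"
  proof (rule sum.cong, simp)
    fix j assume "j \<in> {..<n}"
    hence "(w ^ j) ^ k = (c * w ^ \<sigma> j) ^ k" using c by simp
    hence "w ^ (k * j) = c ^ k * w ^ (k * \<sigma> j)"
      by (simp add: power_mult_distrib mult.commute[of k] power_mult)
    thus "pconst (w ^ (k * j)) * pvar (\<sigma> j) = pconst (c ^ k * w ^ (k * \<sigma> j)) * pvar (\<sigma> j)" by simp
  qed
  also have "\<dots> = (\<Sum>j<n. pconst (c ^ k * w ^ (k * j)) * pvar j)"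
    using sum.reindex_bij_betw[OF \<sigma>, of "\<lambda>j. pconst (c ^ k * w ^ (k * j)) * pvar j"] .
  also have "\<dots> = pconst (c ^ k) * dft_form n w k"
    by (simp add: dft_form_def lform_scale flip: lform_def)
  finally show ?thesis .
qed

section \<open>The kernels of the two differential operators\<close>

text \<open>
  In \<open>n\<close> variables these are the polynomials in the product \<open>x\<^sub>0 \<cdots> x\<^sub>n\<^sub>-\<^sub>1\<close>. After the Fourier
  substitution this product becomes the determinant of the generic circulant matrix.
\<close>
definition balanced :: "nat \<Rightarrow> cpoly \<Rightarrow> bool" where
  "balanced n g \<longleftrightarrow> (\<forall>m\<in>Poly_Mapping.keys g. \<forall>k<n. Poly_Mapping.lookup m k = Poly_Mapping.lookup m 0)"

text \<open>
  The monomial with exponents \<open>m\<^sub>k\<close> has eigenvalue \<open>\<Sum>\<^sub>k m\<^sub>k c\<^sup>k\<close>, and this is where primality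
  enters: it vanishes only if all \<open>m\<^sub>k\<close> agree.
\<close>
lemma vector_field_kernel_iff_balanced:
  assumes n: "prime n" and w: "primitive_root_of_unity n w"
    and \<sigma>: "bij_betw \<sigma> {..<n} {..<n}" and c: "\<And>j. j < n \<Longrightarrow> w ^ j = c * w ^ \<sigma> j"
    and c1: "c ^ n = 1" "c \<noteq> 1" and g: "g \<in> poly_ring n"
  shows "vector_field n (\<lambda>i. pvar (\<sigma> i)) (psubst (dft_form n w) g) = 0 \<longleftrightarrow> balanced n g"
proof -
  let ?L = "vector_field n (\<lambda>i. pvar (\<sigma> i))" and ?y = "dft_form n w"
  define ev where "ev m = (\<Sum>k\<in>Poly_Mapping.keys m. of_nat (Poly_Mapping.lookup m k) * c ^ k)" for m
  have "?L (psubst ?y g) = 0 \<longleftrightarrow> (\<forall>m\<in>Poly_Mapping.keys g. ev m = 0)"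
  proof (rule diagonal_operator_psubst_eq_0_iff[OF _ psubst_dft_form_inj[OF w] _ g])
    have L: "derivation ?L" by (rule derivation_vector_field)
    thus "?L (f + h) = ?L f + ?L h" for f h by (simp add: derivation_def)
    show "?L (pconst a * pmonom ?y m) = pconst (ev m) * (pconst a * pmonom ?y m)" for m a
      unfolding derivation_pconst_mult[OF L] ev_def
      by (subst derivation_eigen_pmonom[OF L vector_field_dft_form[OF \<sigma> c]]) (simp_all add: mult_ac)
  qed
  also have "\<dots> \<longleftrightarrow> balanced n g"
    unfolding balanced_def
  proof (intro ball_cong refl)
    fix m assume m: "m \<in> Poly_Mapping.keys g"
    have ev: "ev m = (\<Sum>k<n. of_int (int (Poly_Mapping.lookup m k)) * c ^ k)"
      unfolding ev_def using poly_ringD[OF g m]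
      by (intro sum.mono_neutral_cong_left) (auto simp: in_keys_iff)
    show "ev m = 0 \<longleftrightarrow> (\<forall>k<n. Poly_Mapping.lookup m k = Poly_Mapping.lookup m 0)"
    proof
      assume "ev m = 0"
      hence "int (Poly_Mapping.lookup m k) = int (Poly_Mapping.lookup m 0)" if "k < n" for k
        unfolding ev using that by (rule integer_relation_roots_of_unity_prime[OF n c1])
      thus "\<forall>k<n. Poly_Mapping.lookup m k = Poly_Mapping.lookup m 0"
        unfolding of_nat_eq_iff by blast
    next
      assume "\<forall>k<n. Poly_Mapping.lookup m k = Poly_Mapping.lookup m 0"
      hence "ev m = (\<Sum>k<n. of_nat (Poly_Mapping.lookup m 0) * c ^ k)"
        unfolding ev of_int_of_nat_eq by (metis (no_types, lifting) lessThan_iff sum.cong)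
      hence "ev m = of_nat (Poly_Mapping.lookup m 0) * (\<Sum>k<n. c ^ k)"
        by (simp only: sum_distrib_left)
      thus "ev m = 0" using c1 by (simp add: geometric_sum)
    qed
  qed
  finally show ?thesis .
qed

lemma cyclic_shifts:
  fixes n :: nat assumes "n > 0" "j < n"
  shows "((j + n - 1) mod n + 1) mod n = j" "((j + 1) mod n + n - 1) mod n = j"
proof -
  show "((j + n - 1) mod n + 1) mod n = j" using assms by (simp add: mod_simps)
  show "((j + 1) mod n + n - 1) mod n = j"
    using assms by (cases "j + 1 = n") auto
qed

lemma
  assumes n: "prime n" and w: "primitive_root_of_unity n w" and g: "g \<in> poly_ring n"
  shows op_D_eq_0_iff_balanced: "op_D n (psubst (dft_form n w) g) = 0 \<longleftrightarrow> balanced n g"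
    and op_Delta_eq_0_iff_balanced: "op_Delta n (psubst (dft_form n w) g) = 0 \<longleftrightarrow> balanced n g"
proof -
  have n2: "n \<ge> 2" using n prime_ge_2_nat by blast
  have wn: "w ^ n = 1" and w1: "w \<noteq> 1" using w n2 by (auto simp: primitive_root_of_unity_def dest: spec[of _ 1])
  have w0: "w \<noteq> 0" using wn n2 by (auto simp: power_0_left)
  let ?p = "\<lambda>i. (i + n - 1) mod n" and ?s = "\<lambda>i. (i + 1) mod n"
  have shifts: "?s (?p j) = j" "?p (?s j) = j" if "j \<in> {..<n}" for j
    using cyclic_shifts[of n j] that n2 by simp_all
  have into: "?p ` {..<n} \<subseteq> {..<n}" "?s ` {..<n} \<subseteq> {..<n}" using n2 by auto
  have bijs: "bij_betw ?p {..<n} {..<n}" "bij_betw ?s {..<n} {..<n}"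
    using shifts into by (blast intro: bij_betw_byWitness[of _ ?s] bij_betw_byWitness[of _ ?p])+
  have p: "w ^ j = w * w ^ ?p j" if "j < n" for j
  proof -
    have "w * w ^ ?p j = w ^ (Suc (j + n - 1))" by (simp add: root_of_unity_power_mod[OF wn])
    also have "Suc (j + n - 1) = j + n" using n2 by simp
    finally show ?thesis by (simp add: power_add wn)
  qed
  have s: "w ^ j = inverse w * w ^ ?s j" if "j < n" for j
    using w0 by (simp add: root_of_unity_power_mod[OF wn])
  show "op_D n (psubst (dft_form n w) g) = 0 \<longleftrightarrow> balanced n g"
    using vector_field_kernel_iff_balanced[OF n w bijs(1) p wn w1 g]
    by (simp add: op_D_def vector_field_def)
  have "inverse w ^ n = 1" "inverse w \<noteq> 1" using wn w1 by (simp_all add: power_inverse)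
  from vector_field_kernel_iff_balanced[OF n w bijs(2) s this g]
  show "op_Delta n (psubst (dft_form n w) g) = 0 \<longleftrightarrow> balanced n g"
    by (simp add: op_Delta_def vector_field_def)
qed

section \<open>Invariants of the circulant matrices of determinant one\<close>

definition circ_mat :: "nat \<Rightarrow> (nat \<Rightarrow> complex) \<Rightarrow> complex mat" where
  "circ_mat n a = mat n n (\<lambda>(r, s). a (nat ((int r - int s) mod int n)))"

lemma circulant_iff: "circulant n A \<longleftrightarrow> (\<exists>a. A = circ_mat n a)"
proof
  assume "circulant n A"
  then obtain a where "A \<in> carrier_mat n n"
      "\<forall>r<n. \<forall>s<n. A $$ (r, s) = a (nat ((int r - int s) mod int n))"
    by (auto simp: circulant_def)
  hence "A = circ_mat n a" by (auto simp: circ_mat_def)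
  thus "\<exists>a. A = circ_mat n a" by blast
qed (auto simp: circulant_def circ_mat_def)

text \<open>
  The rows of the Fourier matrix are left eigenvectors of every circulant matrix; the eigenvalues are
  the discrete Fourier transform of the first column.
\<close>
lemma circ_mat_dft:
  assumes w: "w ^ n = 1" and s: "s < n"
  shows "(\<Sum>r<n. w ^ (k * r) * circ_mat n a $$ (r, s)) = (\<Sum>l<n. w ^ (k * l) * a l) * w ^ (k * s)"
proof -
  have "(\<Sum>r<n. w ^ (k * r) * circ_mat n a $$ (r, s))
      = (\<Sum>l<n. w ^ (k * l) * a l * w ^ (k * s))"
  proof (rule sum.reindex_bij_witness[where i = "\<lambda>l. (l + s) mod n" and j = "\<lambda>r. nat ((int r - int s) mod int n)"])
    fix r assume r: "r \<in> {..<n}"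
    let ?l = "nat ((int r - int s) mod int n)"
    have "int ((?l + s) mod n) = int r"
      using r s by (simp add: zmod_int mod_simps)
    thus rs: "(?l + s) mod n = r" by linarith
    show "?l \<in> {..<n}" using s by (simp add: nat_less_iff)
    have "w ^ (k * r) = (w ^ ((?l + s) mod n)) ^ k" unfolding rs by (simp add: mult.commute flip: power_mult)
    also have "\<dots> = w ^ (k * ?l) * w ^ (k * s)"
      by (simp add: root_of_unity_power_mod[OF w] algebra_simps flip: power_mult power_add)
    finally show "w ^ (k * ?l) * a ?l * w ^ (k * s) = w ^ (k * r) * circ_mat n a $$ (r, s)"
      using r s by (simp add: circ_mat_def)
  next
    fix l assume l: "l \<in> {..<n}"
    show "(l + s) mod n \<in> {..<n}" using s by simp
    have "(int ((l + s) mod n) - int s) mod int n = int l"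
      using l by (simp add: zmod_int mod_simps)
    thus "nat ((int ((l + s) mod n) - int s) mod int n) = l" by simp
  qed
  thus ?thesis by (simp add: sum_distrib_right)
qed

lemma mat_act_circ_mat_dft_form:
  assumes "w ^ n = 1"
  shows "mat_act (circ_mat n a) (dft_form n w k) = pconst (\<Sum>l<n. w ^ (k * l) * a l) * dft_form n w k"
proof -
  have "mat_act (circ_mat n a) (dft_form n w k) = lform n (\<lambda>s. \<Sum>r<n. w ^ (k * r) * circ_mat n a $$ (r, s))"
  proof -
    have "dim_col (circ_mat n a) = n" by (simp add: circ_mat_def)
    thus ?thesis by (simp only: mat_act_alt dft_form_def psubst_lform_lform)
  qed
  also have "\<dots> = lform n (\<lambda>s. (\<Sum>l<n. w ^ (k * l) * a l) * w ^ (k * s))"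
    by (rule lform_cong) (rule circ_mat_dft[OF assms])
  finally show ?thesis by (simp add: lform_scale dft_form_def)
qed

lemma det_circ_mat:
  assumes w: "primitive_root_of_unity n w"
  shows "det (circ_mat n a) = (\<Prod>k<n. \<Sum>l<n. w ^ (k * l) * a l)"
proof -
  have wn: "w ^ n = 1" and n: "n > 0" using w by (auto simp: primitive_root_of_unity_def)
  define d where "d k = (\<Sum>l<n. w ^ (k * l) * a l)" for k
  define F where "F = mat n n (\<lambda>(k, j). w ^ (k * j))"
  define F' where "F' = mat n n (\<lambda>(j, l). inverse (of_nat n) * inverse w ^ (j * l))"
  define E where "E = mat n n (\<lambda>(k, j). if k = j then d k else 0)"
  have carr: "F \<in> carrier_mat n n" "F' \<in> carrier_mat n n" "E \<in> carrier_mat n n" 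
    "circ_mat n a \<in> carrier_mat n n"
    by (simp_all add: F_def F'_def E_def circ_mat_def)
  have "F * F' = 1\<^sub>m n"
  proof (rule eq_matI)
    fix i l assume "i < dim_row (1\<^sub>m n :: complex mat)" "l < dim_col (1\<^sub>m n :: complex mat)"
    hence il: "i < n" "l < n" by simp_all
    have "(F * F') $$ (i, l) = (\<Sum>j<n. w ^ (i * j) * (inverse (of_nat n) * inverse w ^ (j * l)))"
      using il by (simp add: F_def F'_def scalar_prod_def lessThan_atLeast0)
    also have "\<dots> = 1\<^sub>m n $$ (i, l)"
      using root_of_unity_orthogonality[OF w il] n il
      by (simp add: mult.left_commute flip: sum_distrib_left)
    finally show "(F * F') $$ (i, l) = 1\<^sub>m n $$ (i, l)" .
  qed (use carr in auto)
  hence "det F * det F' = 1" using det_mult[OF carr(1,2)] by simp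
  hence F0: "det F \<noteq> 0" by auto
  have "F * circ_mat n a = E * F"
  proof (rule eq_matI)
    fix k s assume "k < dim_row (E * F)" "s < dim_col (E * F)"
    hence ks: "k < n" "s < n" using carr by simp_all
    have "(F * circ_mat n a) $$ (k, s) = (\<Sum>r<n. w ^ (k * r) * circ_mat n a $$ (r, s))"
      using ks carr by (simp add: F_def scalar_prod_def lessThan_atLeast0)
    also have "\<dots> = d k * w ^ (k * s)" unfolding d_def by (rule circ_mat_dft[OF wn ks(2)])
    also have "\<dots> = (\<Sum>j<n. (if k = j then d k else 0) * w ^ (j * s))"
      using ks by (simp add: if_distrib[of "\<lambda>x. x * _"] cong: if_cong)
    also have "\<dots> = (E * F) $$ (k, s)"
      using ks by (simp add: E_def F_def scalar_prod_def lessThan_atLeast0)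
    finally show "(F * circ_mat n a) $$ (k, s) = (E * F) $$ (k, s)" .
  qed (use carr in auto)
  hence "det F * det (circ_mat n a) = det E * det F"
    using det_mult[OF carr(1,4)] det_mult[OF carr(3,1)] by metis
  hence "det (circ_mat n a) = det E" using F0 by simp
  also have "det E = prod_list (diag_mat E)"
    by (rule det_upper_triangular[OF _ carr(3)]) (auto simp: E_def upper_triangular_def)
  also have "diag_mat E = map d [0..<n]"
    by (auto simp: diag_mat_def E_def)
  also have "prod_list \<dots> = (\<Prod>k<n. d k)"
    by (simp add: prod.list_conv_set_nth lessThan_atLeast0)
  finally show ?thesis by (simp add: d_def)
qed

text \<open>
  Circulant matrices are plentiful: inverting the Fourier transform, any \<open>n\<close> numbers occur as the
  eigenvalues of one of them.
\<close>
lemma circ_mat_with_eigenvalues: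
  assumes w: "primitive_root_of_unity n w"
  shows "\<exists>a. \<forall>k<n. (\<Sum>l<n. w ^ (k * l) * a l) = d k"
proof (intro exI allI impI)
  fix k assume k: "k < n"
  have n: "n > 0" using k by simp
  let ?a = "\<lambda>l. \<Sum>j<n. inverse (of_nat n) * inverse w ^ (l * j) * d j"
  have "(\<Sum>l<n. w ^ (k * l) * ?a l)
      = (\<Sum>j<n. inverse (of_nat n) * d j * (\<Sum>l<n. w ^ (k * l) * inverse w ^ (l * j)))"
    unfolding sum_distrib_left by (subst sum.swap) (simp add: mult_ac)
  also have "\<dots> = (\<Sum>j<n. if j = k then d j else 0)"
    by (rule sum.cong) (use n k in \<open>auto simp: root_of_unity_orthogonality[OF w]\<close>)
  also have "\<dots> = d k" using k by simp
  finally show "(\<Sum>l<n. w ^ (k * l) * ?a l) = d k" .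
qed

lemma mat_act_circ_mat_fixes_iff:
  fixes n :: nat and a :: "nat \<Rightarrow> complex" and w :: complex
  defines "d \<equiv> \<lambda>k. \<Sum>l<n. w ^ (k * l) * a l"
  assumes w: "primitive_root_of_unity n w" and g: "g \<in> poly_ring n"
  shows "mat_act (circ_mat n a) (psubst (dft_form n w) g) = psubst (dft_form n w) g \<longleftrightarrow>
    (\<forall>m\<in>Poly_Mapping.keys g. (\<Prod>k<n. d k ^ Poly_Mapping.lookup m k) = 1)"
proof -
  let ?A = "circ_mat n a" and ?y = "dft_form n w"
  have wn: "w ^ n = 1" using w by (simp add: primitive_root_of_unity_def)
  define T where "T f = mat_act ?A f - f" for f
  define ev where "ev m = (\<Prod>k<n. d k ^ Poly_Mapping.lookup m k) - 1" for m
  have "T (psubst ?y g) = 0 \<longleftrightarrow> (\<forall>m\<in>Poly_Mapping.keys g. ev m = 0)"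
  proof (rule diagonal_operator_psubst_eq_0_iff[OF _ psubst_dft_form_inj[OF w] _ g])
    show "T (f + h) = T f + T h" for f h by (simp add: T_def mat_act_alt psubst_add)
    show "T (pconst c * pmonom ?y m) = pconst (ev m) * (pconst c * pmonom ?y m)"
      if m: "Poly_Mapping.keys m \<subseteq> {..<n}" for m c
    proof -
      have "mat_act ?A (pmonom ?y m) = pmonom (\<lambda>k. pconst (d k) * ?y k) m"
        using mat_act_circ_mat_dft_form[OF wn] by (simp add: mat_act_alt psubst_pmonom d_def)
      also have "\<dots> = pconst (\<Prod>k<n. d k ^ Poly_Mapping.lookup m k) * pmonom ?y m"
        by (simp add: pmonom_superset[OF _ m] pconst_prod pconst_power power_mult_distrib prod.distrib)
      finally have "mat_act ?A (pconst c * pmonom ?y m) =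
          pconst c * (pconst (\<Prod>k<n. d k ^ Poly_Mapping.lookup m k) * pmonom ?y m)"
        by (simp add: mat_act_alt psubst_mult)
      thus ?thesis by (simp add: T_def ev_def pconst_diff algebra_simps)
    qed
  qed
  thus ?thesis by (simp add: T_def ev_def)
qed

text \<open>
  In Fourier coordinates the group is the full torus of diagonal matrices with determinant one. A
  monomial whose exponents all equal \<open>e\<close> is multiplied by the \<open>e\<close>-th power of the determinant,
  hence fixed. Conversely, the diagonal matrix with entries \<open>2\<close> and \<open>1/2\<close> at positions \<open>0\<close> and \<open>i\<close>,
  and \<open>1\<close> elsewhere, forces the exponents at these two positions to agree.
\<close>
lemma invariant_iff_balanced:
  assumes n: "n \<ge> 2" and w: "primitive_root_of_unity n w" and g: "g \<in> poly_ring n"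
  shows "(\<forall>A\<in>SL_cyclic n. mat_act A (psubst (dft_form n w) g) = psubst (dft_form n w) g) \<longleftrightarrow> balanced n g"
    (is "?inv \<longleftrightarrow> _")
proof
  assume bal: "balanced n g"
  show ?inv
  proof
    fix A assume A: "A \<in> SL_cyclic n"
    then obtain a where a: "A = circ_mat n a" by (auto simp: SL_cyclic_def circulant_iff)
    define d where "d k = (\<Sum>l<n. w ^ (k * l) * a l)" for k
    have "(\<Prod>k<n. d k) = 1" using A by (simp add: a d_def det_circ_mat[OF w] SL_cyclic_def SL_def)
    moreover have "(\<Prod>k<n. d k ^ Poly_Mapping.lookup m k) = (\<Prod>k<n. d k) ^ Poly_Mapping.lookup m 0"
      if "m \<in> Poly_Mapping.keys g" for m
      unfolding prod_power_distrib
      by (rule prod.cong) (use bal that in \<open>metis balanced_def lessThan_iff\<close>)+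
    ultimately show "mat_act A (psubst (dft_form n w) g) = psubst (dft_form n w) g"
      unfolding a mat_act_circ_mat_fixes_iff[OF w g] d_def by simp
  qed
next
  assume inv: ?inv
  show "balanced n g"
    unfolding balanced_def
  proof (intro ballI allI impI)
    fix m i assume m: "m \<in> Poly_Mapping.keys g" and i: "i < n"
    show "Poly_Mapping.lookup m i = Poly_Mapping.lookup m 0"
    proof (cases "i = 0")
      case False
      define d :: "nat \<Rightarrow> complex" where "d = (\<lambda>_. 1)(0 := 2, i := 1/2)"
      have split: "(\<Prod>k<n. h k) = h 0 * (h i * (\<Prod>k\<in>{..<n} - {0} - {i}. h k))" for h :: "nat \<Rightarrow> complex"
        using i n False by (simp add: prod.remove[of "{..<n}" 0] prod.remove[of "{..<n} - {0}" i])
      have "(\<Prod>k<n. d k ^ u k) = 2 ^ u 0 * (1/2) ^ u i" for u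
      proof -
        have "(\<Prod>k\<in>{..<n} - {0} - {i}. d k ^ u k) = 1" by (rule prod.neutral) (simp add: d_def)
        thus ?thesis unfolding split using False by (simp add: d_def)
      qed
      note prod_d = this this[of "\<lambda>_. 1"]
      obtain a where a: "\<And>k. k < n \<Longrightarrow> (\<Sum>l<n. w ^ (k * l) * a l) = d k"
        using circ_mat_with_eigenvalues[OF w] by blast
      have SL: "circ_mat n a \<in> SL_cyclic n"
        using prod_d(2) a
        by (auto simp: SL_cyclic_def SL_def circulant_iff det_circ_mat[OF w]) (simp add: circ_mat_def)
      have "mat_act (circ_mat n a) (psubst (dft_form n w) g) = psubst (dft_form n w) g"
        using inv SL by blast
      hence "(\<Prod>k<n. (\<Sum>l<n. w ^ (k * l) * a l) ^ Poly_Mapping.lookup m k) = 1"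
        using m unfolding mat_act_circ_mat_fixes_iff[OF w g] by blast
      hence "(2::complex) ^ Poly_Mapping.lookup m 0 * (1/2) ^ Poly_Mapping.lookup m i = 1"
        using a by (simp flip: prod_d(1))
      hence "(2::complex) ^ Poly_Mapping.lookup m 0 = 2 ^ Poly_Mapping.lookup m i"
        by (simp add: power_divide)
      hence "(2::real) ^ Poly_Mapping.lookup m 0 = 2 ^ Poly_Mapping.lookup m i"
        by (metis norm_numeral norm_power)
      thus ?thesis by simp
    qed simp
  qed
qed

section \<open>Invariants and kernels coincide\<close>

theorem corollary6:
  fixes G :: "('g, 'b) monoid_scheme" and n :: nat
  assumes "group G"
    and "Coset.order G = n"
    and "prime n"
  shows "invariants_SL_cyclic n = ker_D n \<and> ker_D n = ker_Delta n"
proof -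
  have n2: "n \<ge> 2" using \<open>prime n\<close> prime_ge_2_nat by blast
  then obtain w where w: "primitive_root_of_unity n w"
    using primitive_root_of_unity_exists[of n] by auto
  have "(f \<in> invariants_SL_cyclic n \<longleftrightarrow> f \<in> ker_D n) \<and> (f \<in> ker_D n \<longleftrightarrow> f \<in> ker_Delta n)" for f
  proof (cases "f \<in> poly_ring n")
    case True
    then obtain g where "g \<in> poly_ring n" "f = psubst (dft_form n w) g"
      using psubst_dft_form_surj[OF w] by blast
    thus ?thesis
      using True invariant_iff_balanced[OF n2 w] op_D_eq_0_iff_balanced[OF \<open>prime n\<close> w]
        op_Delta_eq_0_iff_balanced[OF \<open>prime n\<close> w]
      by (simp add: invariants_SL_cyclic_def ker_D_def ker_Delta_def)
  qed (simp add: invariants_SL_cyclic_def ker_D_def ker_Delta_def)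
  thus ?thesis by blast
qed

end
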